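(* Let $A$ be a ring and let $R$ be the $n$-by-$n$ generalized matrix ring of the form $$R=\begin{bmatrix} A & A & \cdots & A \\ X_{21} & A & \cdots & A \\ \vdots & \ddots & \ddots & \vdots \\ X_{n1} & \cdots & X_{n,n-1} & A \end{bmatrix},$$ where $X_{ij}=A$ for $i\leq j$, $X_{ij}\trianglelefteq A$ for $j<i$, $X_{j1}\subseteq X_{j2}\subseteq\cdots\subseteq X_{jn}$ and $X_{ni}\subseteq X_{n-1,i}\subseteq\cdots\subseteq X_{1i}$, for all $1\leq i\leq n$ and $1\leq j\leq n$. Then $A$ is ideal extending if and only if $R$ is ideal extending.
   Context: All rings are associative with unity. $X\trianglelefteq A$ means $X$ is a (two-sided) ideal of $A$. $R$ is the set of $n$-by-$n$ matrices over $A$ with $(i,j)$-entry in $X_{ij}$, assumed to be a ring under the usual matrix addition and multiplication. $\mathcal{B}(R)$ denotes the set of central idempotents of $R$. For $X\subseteq Y$ both left or both right ideals of a ring $R$, $X$ is ideal essential in $Y$ if $X\cap I\neq0$ for each nonzero ideal $I\trianglelefteq R$ with $I\subseteq Y$. A ring $R$ is ideal extending if for each $X\trianglelefteq R$ there is $e\in\mathcal{B}(R)$ such that $X$ is ideal essential in $eR$ (in particular $X\subseteq eR$). *)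

theory Defs
  imports "HOL-Algebra.Ideal" "HOL-Algebra.FiniteProduct"
begin

text \<open>Rings are those of HOL-Algebra: associative with unity, not necessarily commutative, and
  possibly zero. The library's \<^const>\<open>ideal\<close> is two-sided.\<close>

definition left_ideal :: "'a set \<Rightarrow> ('a, 'b) ring_scheme \<Rightarrow> bool" where
  "left_ideal I R \<longleftrightarrow> additive_subgroup I R \<and>
     (\<forall>a\<in>I. \<forall>x\<in>carrier R. x \<otimes>\<^bsub>R\<^esub> a \<in> I)"

definition right_ideal :: "'a set \<Rightarrow> ('a, 'b) ring_scheme \<Rightarrow> bool" where
  "right_ideal I R \<longleftrightarrow> additive_subgroup I R \<and>
     (\<forall>a\<in>I. \<forall>x\<in>carrier R. a \<otimes>\<^bsub>R\<^esub> x \<in> I)"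

definition central_idempotents :: "('a, 'b) ring_scheme \<Rightarrow> 'a set" where
  "central_idempotents R =
     {e \<in> carrier R. e \<otimes>\<^bsub>R\<^esub> e = e \<and> (\<forall>x\<in>carrier R. e \<otimes>\<^bsub>R\<^esub> x = x \<otimes>\<^bsub>R\<^esub> e)}"

text \<open>The test ideals \<open>I\<close> are two-sided ideals of the whole ring \<open>R\<close>, even though \<open>X\<close> and \<open>Y\<close>
  need only be one-sided (on a common side).\<close>

definition ideal_essential :: "('a, 'b) ring_scheme \<Rightarrow> 'a set \<Rightarrow> 'a set \<Rightarrow> bool" where
  "ideal_essential R X Y \<longleftrightarrow>
     (left_ideal X R \<and> left_ideal Y R \<or> right_ideal X R \<and> right_ideal Y R) \<and>
     X \<subseteq> Y \<and>
     (\<forall>I. ideal I R \<and> I \<noteq> {\<zero>\<^bsub>R\<^esub>} \<and> I \<subseteq> Y \<longrightarrow> X \<inter> I \<noteq> {\<zero>\<^bsub>R\<^esub>})"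

definition ideal_extending :: "('a, 'b) ring_scheme \<Rightarrow> bool" where
  "ideal_extending R \<longleftrightarrow> ring R \<and>
     (\<forall>X. ideal X R \<longrightarrow>
        (\<exists>e\<in>central_idempotents R. ideal_essential R X {e \<otimes>\<^bsub>R\<^esub> r | r. r \<in> carrier R}))"

text \<open>Matrices with rows and columns indexed by \<open>{1..n}\<close> and \<open>(i, j)\<close>-entry in \<open>X i j\<close>, represented
  by functions that are \<^const>\<open>undefined\<close> outside the index range, so that equality of matrices is
  equality of entries. For arbitrary \<open>X\<close> the carrier need not be closed under the operations, so
  this record need not be a ring.\<close>

definition gen_matrix_ring ::
  "('a, 'b) ring_scheme \<Rightarrow> nat \<Rightarrow> (nat \<Rightarrow> nat \<Rightarrow> 'a set) \<Rightarrow> (nat \<Rightarrow> nat \<Rightarrow> 'a) ring" where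
  "gen_matrix_ring A n X =
     \<lparr>carrier = (\<Pi>\<^sub>E i\<in>{1..n}. \<Pi>\<^sub>E j\<in>{1..n}. X i j),
      mult = (\<lambda>M N. \<lambda>i\<in>{1..n}. \<lambda>j\<in>{1..n}. \<Oplus>\<^bsub>A\<^esub>k\<in>{1..n}. M i k \<otimes>\<^bsub>A\<^esub> N k j),
      one = (\<lambda>i\<in>{1..n}. \<lambda>j\<in>{1..n}. if i = j then \<one>\<^bsub>A\<^esub> else \<zero>\<^bsub>A\<^esub>),
      zero = (\<lambda>i\<in>{1..n}. \<lambda>j\<in>{1..n}. \<zero>\<^bsub>A\<^esub>),
      add = (\<lambda>M N. \<lambda>i\<in>{1..n}. \<lambda>j\<in>{1..n}. M i j \<oplus>\<^bsub>A\<^esub> N i j)\<rparr>"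

end

theory Submission imports Defs begin

text \<open>
  Write \<open>R\<close> for the matrix ring and \<open>E\<^sub>p\<^sub>q\<close> for the matrix units; \<open>R\<close> contains \<open>a E\<^sub>p\<^sub>q\<close> for every
  \<open>a\<close> in \<open>A\<close> and \<open>p \<le> q\<close>. The proof compares the two-sided ideals of \<open>R\<close> and \<open>A\<close> through the upper
  right corner: an ideal \<open>J\<close> of \<open>R\<close> is sent to the set of all \<open>a\<close> with \<open>a E\<^sub>1\<^sub>n \<in> J\<close>. Since
  \<open>E\<^sub>1\<^sub>i M E\<^sub>j\<^sub>n = M\<^sub>i\<^sub>j E\<^sub>1\<^sub>n\<close>, this corner collects all entries of all members of \<open>J\<close>
  (\<open>entry_in_corner\<close>). The corner map therefore sends only the zero ideal to zero
  (\<open>corner_eq_zero_iff\<close>), and it obviously preserves intersections. It is onto, because the matrices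
  of \<open>R\<close> with all entries in an ideal \<open>K\<close> of \<open>A\<close> form an ideal of \<open>R\<close> with corner \<open>K\<close>
  (\<open>corner_entrywise\<close>).

  Commuting with the matrix units forces a central idempotent of \<open>R\<close> to be a scalar matrix, so the
  central idempotents of \<open>R\<close> are those of \<open>A\<close> placed on the diagonal
  (\<open>central_idempotents_gen_matrix_ring\<close>). An ideal of \<open>R\<close> is contained in the summand generated by
  such a scalar exactly if its corner is contained in the corresponding summand of \<open>A\<close>
  (\<open>fixed_corner_iff\<close>). Being ideal extending speaks only of containment of ideals in such summands,
  of intersections and of being zero, hence it transfers along the corner map in both directions.
\<close>

section \<open>Ideal extending rings\<close>

text \<open>For a central idempotent \<open>e\<close> the summand \<open>eR\<close> consists of the elements fixed by \<open>e\<close>, and the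
  one-sidedness clauses hold automatically for two-sided ideals.\<close>

lemma (in ring) ideal_extending_iff:
  "ideal_extending R \<longleftrightarrow>
     (\<forall>X. ideal X R \<longrightarrow>
        (\<exists>e\<in>central_idempotents R. (\<forall>x\<in>X. e \<otimes> x = x) \<and>
           (\<forall>I. ideal I R \<and> I \<noteq> {\<zero>} \<and> (\<forall>x\<in>I. e \<otimes> x = x) \<longrightarrow> X \<inter> I \<noteq> {\<zero>})))"
proof -
  have "ideal_essential R X {e \<otimes> r | r. r \<in> carrier R} \<longleftrightarrow>
        (\<forall>x\<in>X. e \<otimes> x = x) \<and>
        (\<forall>I. ideal I R \<and> I \<noteq> {\<zero>} \<and> (\<forall>x\<in>I. e \<otimes> x = x) \<longrightarrow> X \<inter> I \<noteq> {\<zero>})"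
    if X: "ideal X R" and e: "e \<in> central_idempotents R" for X e
  proof -
    let ?S = "{e \<otimes> r | r. r \<in> carrier R}"
    have ec: "e \<in> carrier R" "e \<otimes> e = e"
      using e by (auto simp: central_idempotents_def)
    have fixed: "x \<in> ?S \<longleftrightarrow> e \<otimes> x = x" if "x \<in> carrier R" for x
    proof
      assume "x \<in> ?S"
      then obtain r where "r \<in> carrier R" "x = e \<otimes> r" by blast
      then show "e \<otimes> x = x" using ec by (metis m_assoc)
    next
      assume "e \<otimes> x = x"
      then show "x \<in> ?S" using that by (metis (mono_tags, lifting) mem_Collect_eq)
    qed
    have sub: "I \<subseteq> ?S \<longleftrightarrow> (\<forall>x\<in>I. e \<otimes> x = x)" if "ideal I R" for I
      using fixed ideal.Icarr[OF that] by blast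
    have "additive_subgroup ?S R"
    proof (intro additive_subgroup.intro subgroup.intro)
      show "\<one>\<^bsub>add_monoid R\<^esub> \<in> ?S"
        using ec by (auto intro!: exI[of _ "\<zero>"])
    next
      fix x y assume "x \<in> ?S" "y \<in> ?S"
      then obtain r s where "r \<in> carrier R" "s \<in> carrier R" "x = e \<otimes> r" "y = e \<otimes> s" by blast
      then show "x \<otimes>\<^bsub>add_monoid R\<^esub> y \<in> ?S"
        using ec by (auto intro!: exI[of _ "r \<oplus> s"] simp: r_distr)
    next
      fix x assume "x \<in> ?S"
      then obtain r where r: "r \<in> carrier R" "x = e \<otimes> r" by blast
      then have "\<ominus> x \<in> ?S"
        using ec by (auto intro!: exI[of _ "\<ominus> r"] simp: r_minus)
      then show "inv\<^bsub>add_monoid R\<^esub> x \<in> ?S" by (simp add: a_inv_def)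
    qed (use ec in auto)
    moreover have "x \<otimes> y \<in> ?S" if "x \<in> ?S" "y \<in> carrier R" for x y
      using that ec by (auto simp: m_assoc)
    ultimately have "right_ideal ?S R" by (auto simp: right_ideal_def)
    moreover have "right_ideal X R"
      using X by (auto simp: right_ideal_def ideal.I_r_closed ideal.axioms(1))
    ultimately show ?thesis
      unfolding ideal_essential_def using sub[OF X] by (simp add: sub cong: conj_cong)
  qed
  then show ?thesis
    unfolding ideal_extending_def using ring_axioms by (simp cong: imp_cong bex_cong)
qed

text \<open>Closure under negation comes for free from multiplication by \<open>\<ominus> \<one>\<close>.\<close>

lemma (in ring) ideal_if_closed:
  assumes "I \<subseteq> carrier R" "\<zero> \<in> I"
    and "\<And>x y. x \<in> I \<Longrightarrow> y \<in> I \<Longrightarrow> x \<oplus> y \<in> I"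
    and "\<And>x r. x \<in> I \<Longrightarrow> r \<in> carrier R \<Longrightarrow> r \<otimes> x \<in> I"
    and "\<And>x r. x \<in> I \<Longrightarrow> r \<in> carrier R \<Longrightarrow> x \<otimes> r \<in> I"
  shows "ideal I R"
proof (rule idealI)
  show "subgroup I (add_monoid R)"
  proof
    fix x assume x: "x \<in> I"
    have "(\<ominus> \<one>) \<otimes> x \<in> I" using x assms(4) by simp
    moreover have "(\<ominus> \<one>) \<otimes> x = \<ominus> x" using x assms(1) by (simp add: l_minus subset_iff)
    ultimately show "inv\<^bsub>add_monoid R\<^esub> x \<in> I" by (simp add: a_inv_def)
  qed (use assms in auto)
qed (use assms ring_axioms in auto)

section \<open>Matrix units and scalar matrices\<close>

locale upper_gen_matrix_ring = ring A for A :: "('a, 'b) ring_scheme" (structure) +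
  fixes n :: nat and X :: "nat \<Rightarrow> nat \<Rightarrow> 'a set"
  assumes n_pos: "n \<ge> 1"
    and upper: "\<And>i j. i \<in> {1..n} \<Longrightarrow> j \<in> {1..n} \<Longrightarrow> i \<le> j \<Longrightarrow> X i j = carrier A"
    and entry_ideal: "\<And>i j. i \<in> {1..n} \<Longrightarrow> j \<in> {1..n} \<Longrightarrow> ideal (X i j) A"
    and ring_gen_matrix_ring: "ring (gen_matrix_ring A n X)"
begin

\<comment> \<open>Otherwise the row index \<open>1\<close> turns into \<open>Suc 0\<close> and the rules about the corner no longer match.\<close>
declare One_nat_def [simp del]

abbreviation R :: "(nat \<Rightarrow> nat \<Rightarrow> 'a) ring" where
  "R \<equiv> gen_matrix_ring A n X"

sublocale R: ring R
  by (rule ring_gen_matrix_ring)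

definition matrix_unit :: "'a \<Rightarrow> nat \<Rightarrow> nat \<Rightarrow> nat \<Rightarrow> nat \<Rightarrow> 'a" where
  "matrix_unit a p q = (\<lambda>i\<in>{1..n}. \<lambda>j\<in>{1..n}. if i = p \<and> j = q then a else \<zero>)"

definition scalar :: "'a \<Rightarrow> nat \<Rightarrow> nat \<Rightarrow> 'a" where
  "scalar a = (\<lambda>i\<in>{1..n}. \<lambda>j\<in>{1..n}. if i = j then a else \<zero>)"

lemma zero_entry: "i \<in> {1..n} \<Longrightarrow> j \<in> {1..n} \<Longrightarrow> \<zero> \<in> X i j"
  using additive_subgroup.zero_closed[OF ideal.axioms(1)[OF entry_ideal]] .

lemma entry_in: "M \<in> carrier R \<Longrightarrow> i \<in> {1..n} \<Longrightarrow> j \<in> {1..n} \<Longrightarrow> M i j \<in> X i j"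
  by (auto simp: gen_matrix_ring_def PiE_iff)

lemma entry_closed: "M \<in> carrier R \<Longrightarrow> i \<in> {1..n} \<Longrightarrow> j \<in> {1..n} \<Longrightarrow> M i j \<in> carrier A"
  using entry_in ideal.Icarr[OF entry_ideal] by blast

lemma matrix_eqI:
  assumes "M \<in> carrier R" "N \<in> carrier R"
    and "\<And>i j. i \<in> {1..n} \<Longrightarrow> j \<in> {1..n} \<Longrightarrow> M i j = N i j"
  shows "M = N"
proof (rule PiE_ext)
  show "M \<in> (\<Pi>\<^sub>E i\<in>{1..n}. \<Pi>\<^sub>E j\<in>{1..n}. X i j)" "N \<in> (\<Pi>\<^sub>E i\<in>{1..n}. \<Pi>\<^sub>E j\<in>{1..n}. X i j)"
    using assms by (auto simp: gen_matrix_ring_def)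
  then show "M i = N i" if "i \<in> {1..n}" for i
    using assms(3) that by (intro PiE_ext[of "M i" "{1..n}" "X i" "N i"]) (auto dest: PiE_mem)
qed

lemma mult_entry: "i \<in> {1..n} \<Longrightarrow> j \<in> {1..n} \<Longrightarrow>
    (M \<otimes>\<^bsub>R\<^esub> N) i j = (\<Oplus>k\<in>{1..n}. M i k \<otimes> N k j)"
  by (simp add: gen_matrix_ring_def)

lemma add_entry: "i \<in> {1..n} \<Longrightarrow> j \<in> {1..n} \<Longrightarrow> (M \<oplus>\<^bsub>R\<^esub> N) i j = M i j \<oplus> N i j"
  by (simp add: gen_matrix_ring_def)

lemma zero_entry_eq: "i \<in> {1..n} \<Longrightarrow> j \<in> {1..n} \<Longrightarrow> \<zero>\<^bsub>R\<^esub> i j = \<zero>"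
  by (simp add: gen_matrix_ring_def)

lemma matrix_unit_entry: "i \<in> {1..n} \<Longrightarrow> j \<in> {1..n} \<Longrightarrow>
    matrix_unit a p q i j = (if i = p \<and> j = q then a else \<zero>)"
  by (simp add: matrix_unit_def)

lemma scalar_entry: "i \<in> {1..n} \<Longrightarrow> j \<in> {1..n} \<Longrightarrow> scalar a i j = (if i = j then a else \<zero>)"
  by (simp add: scalar_def)

lemma matrix_unit_closed:
  "a \<in> carrier A \<Longrightarrow> p \<in> {1..n} \<Longrightarrow> q \<in> {1..n} \<Longrightarrow> p \<le> q \<Longrightarrow> matrix_unit a p q \<in> carrier R"
  using zero_entry upper by (auto simp: gen_matrix_ring_def matrix_unit_def)

lemma scalar_closed: "a \<in> carrier A \<Longrightarrow> scalar a \<in> carrier R"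
  using zero_entry upper by (auto simp: gen_matrix_ring_def scalar_def)

lemma finsum_delta:
  assumes "p \<in> {1..n}" "\<And>k. k \<in> {1..n} \<Longrightarrow> k \<noteq> p \<Longrightarrow> f k = \<zero>" "f p \<in> carrier A"
  shows "(\<Oplus>k\<in>{1..n}. f k) = f p"
proof -
  have "(\<Oplus>k\<in>{1..n}. f k) = (\<Oplus>k\<in>{1..n}. if p = k then f p else \<zero>)"
    using assms by (intro finsum_cong') auto
  also have "\<dots> = f p"
    using assms add.finprod_singleton[of p "{1..n}" "\<lambda>_. f p"] by simp
  finally show ?thesis .
qed

lemma matrix_unit_mult_entry:
  assumes "a \<in> carrier A" "M \<in> carrier R" "q \<in> {1..n}" "i \<in> {1..n}" "j \<in> {1..n}"
  shows "(matrix_unit a p q \<otimes>\<^bsub>R\<^esub> M) i j = (if i = p then a \<otimes> M q j else \<zero>)"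
  unfolding mult_entry[OF assms(4,5)]
  using assms by (subst finsum_delta[of q]) (auto simp: matrix_unit_entry entry_closed)

lemma mult_matrix_unit_entry:
  assumes "a \<in> carrier A" "M \<in> carrier R" "p \<in> {1..n}" "i \<in> {1..n}" "j \<in> {1..n}"
  shows "(M \<otimes>\<^bsub>R\<^esub> matrix_unit a p q) i j = (if j = q then M i p \<otimes> a else \<zero>)"
  unfolding mult_entry[OF assms(4,5)]
  using assms by (subst finsum_delta[of p]) (auto simp: matrix_unit_entry entry_closed)

lemma scalar_mult_entry:
  assumes "a \<in> carrier A" "M \<in> carrier R" "i \<in> {1..n}" "j \<in> {1..n}"
  shows "(scalar a \<otimes>\<^bsub>R\<^esub> M) i j = a \<otimes> M i j"
  unfolding mult_entry[OF assms(3,4)]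
  using assms by (subst finsum_delta[of i]) (auto simp: scalar_entry entry_closed)

lemma mult_scalar_entry:
  assumes "a \<in> carrier A" "M \<in> carrier R" "i \<in> {1..n}" "j \<in> {1..n}"
  shows "(M \<otimes>\<^bsub>R\<^esub> scalar a) i j = M i j \<otimes> a"
  unfolding mult_entry[OF assms(3,4)]
  using assms by (subst finsum_delta[of j]) (auto simp: scalar_entry entry_closed)

lemma scalar_fixes_iff:
  assumes "c \<in> carrier A" "M \<in> carrier R"
  shows "scalar c \<otimes>\<^bsub>R\<^esub> M = M \<longleftrightarrow> (\<forall>i\<in>{1..n}. \<forall>j\<in>{1..n}. c \<otimes> M i j = M i j)"
proof
  assume "scalar c \<otimes>\<^bsub>R\<^esub> M = M"
  then show "\<forall>i\<in>{1..n}. \<forall>j\<in>{1..n}. c \<otimes> M i j = M i j"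
    using scalar_mult_entry[OF assms] by metis
next
  assume "\<forall>i\<in>{1..n}. \<forall>j\<in>{1..n}. c \<otimes> M i j = M i j"
  then show "scalar c \<otimes>\<^bsub>R\<^esub> M = M"
    using assms by (intro matrix_eqI) (auto simp: scalar_mult_entry scalar_closed)
qed

section \<open>Central idempotents of the matrix ring\<close>

text \<open>Commuting with \<open>E\<^sub>j\<^sub>j\<close> kills the off-diagonal entries of column \<open>j\<close>, and commuting with
  \<open>E\<^sub>1\<^sub>j\<close>, which lies in the ring because it is upper triangular, makes the \<open>j\<close>-th diagonal entry
  equal to the first.\<close>

lemma central_is_scalar:
  assumes e: "e \<in> carrier R" and comm: "\<And>M. M \<in> carrier R \<Longrightarrow> e \<otimes>\<^bsub>R\<^esub> M = M \<otimes>\<^bsub>R\<^esub> e"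
  shows "e = scalar (e 1 1)"
proof (rule matrix_eqI)
  have one: "1 \<in> {1..n}" using n_pos by simp
  show "scalar (e 1 1) \<in> carrier R" using e one by (simp add: scalar_closed entry_closed)
  fix i j assume ij: "i \<in> {1..n}" "j \<in> {1..n}"
  show "e i j = scalar (e 1 1) i j"
  proof (cases "i = j")
    case True
    have "e \<otimes>\<^bsub>R\<^esub> matrix_unit \<one> 1 j = matrix_unit \<one> 1 j \<otimes>\<^bsub>R\<^esub> e"
      using ij one by (intro comm matrix_unit_closed) auto
    then have "(e \<otimes>\<^bsub>R\<^esub> matrix_unit \<one> 1 j) 1 j = (matrix_unit \<one> 1 j \<otimes>\<^bsub>R\<^esub> e) 1 j" by simp
    then have "e 1 1 \<otimes> \<one> = \<one> \<otimes> e j j"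
      using matrix_unit_mult_entry[of \<one> e j 1 j 1] mult_matrix_unit_entry[of \<one> e 1 1 j j] e ij one
      by simp
    then show ?thesis using True e ij one by (simp add: scalar_entry entry_closed)
  next
    case False
    have "e \<otimes>\<^bsub>R\<^esub> matrix_unit \<one> j j = matrix_unit \<one> j j \<otimes>\<^bsub>R\<^esub> e"
      using ij by (intro comm matrix_unit_closed) auto
    then have "(e \<otimes>\<^bsub>R\<^esub> matrix_unit \<one> j j) i j = (matrix_unit \<one> j j \<otimes>\<^bsub>R\<^esub> e) i j" by simp
    then have "e i j \<otimes> \<one> = \<zero>"
      using matrix_unit_mult_entry[of \<one> e j i j j] mult_matrix_unit_entry[of \<one> e j i j j] e ij False
      by simp
    then show ?thesis using False e ij by (simp add: scalar_entry entry_closed)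
  qed
qed (rule e)

lemma scalar_central_idempotent_iff:
  assumes c: "c \<in> carrier A"
  shows "scalar c \<in> central_idempotents R \<longleftrightarrow> c \<in> central_idempotents A"
proof
  have one: "1 \<in> {1..n}" using n_pos by simp
  assume sc: "scalar c \<in> central_idempotents R"
  have "c \<otimes> x = x \<otimes> c" if x: "x \<in> carrier A" for x
  proof -
    have "c \<otimes> x = (scalar c \<otimes>\<^bsub>R\<^esub> scalar x) 1 1"
      using x c one by (simp add: scalar_mult_entry scalar_closed scalar_entry)
    also have "scalar c \<otimes>\<^bsub>R\<^esub> scalar x = scalar x \<otimes>\<^bsub>R\<^esub> scalar c"
      using sc scalar_closed[OF x] by (simp add: central_idempotents_def)
    also have "(scalar x \<otimes>\<^bsub>R\<^esub> scalar c) 1 1 = x \<otimes> c"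
      using x c one by (simp add: scalar_mult_entry scalar_closed scalar_entry)
    finally show ?thesis .
  qed
  moreover have "c \<otimes> c = c"
  proof -
    have "scalar c \<otimes>\<^bsub>R\<^esub> scalar c = scalar c"
      using sc by (simp add: central_idempotents_def)
    then have "c \<otimes> scalar c 1 1 = scalar c 1 1"
      using c one scalar_fixes_iff[OF c scalar_closed[OF c]] by blast
    then show ?thesis using one by (simp add: scalar_entry)
  qed
  ultimately show "c \<in> central_idempotents A"
    using c unfolding central_idempotents_def by blast
next
  assume cc: "c \<in> central_idempotents A"
  then have idem: "c \<otimes> c = c" and comm: "\<And>x. x \<in> carrier A \<Longrightarrow> c \<otimes> x = x \<otimes> c"
    unfolding central_idempotents_def by blast+
  have "scalar c \<otimes>\<^bsub>R\<^esub> scalar c = scalar c"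
    using c idem by (simp add: scalar_fixes_iff scalar_closed scalar_entry)
  moreover have "scalar c \<otimes>\<^bsub>R\<^esub> M = M \<otimes>\<^bsub>R\<^esub> scalar c" if "M \<in> carrier R" for M
  proof (rule matrix_eqI)
    fix i j assume "i \<in> {1..n}" "j \<in> {1..n}"
    then show "(scalar c \<otimes>\<^bsub>R\<^esub> M) i j = (M \<otimes>\<^bsub>R\<^esub> scalar c) i j"
      using c that
      by (simp only: scalar_mult_entry mult_scalar_entry comm[OF entry_closed[OF that]])
  qed (use c that scalar_closed in auto)
  ultimately show "scalar c \<in> central_idempotents R"
    using scalar_closed[OF c] unfolding central_idempotents_def by blast
qed

lemma central_idempotents_gen_matrix_ring:
  "central_idempotents R = scalar ` central_idempotents A"
proof (intro equalityI subsetI)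
  fix e assume e: "e \<in> central_idempotents R"
  then have "e \<in> carrier R" "e = scalar (e 1 1)"
    by (auto simp: central_idempotents_def intro!: central_is_scalar)
  moreover have "e 1 1 \<in> carrier A" using calculation n_pos by (simp add: entry_closed)
  ultimately show "e \<in> scalar ` central_idempotents A"
    using e scalar_central_idempotent_iff by (metis imageI)
next
  fix e assume "e \<in> scalar ` central_idempotents A"
  then show "e \<in> central_idempotents R"
    using scalar_central_idempotent_iff by (auto simp: central_idempotents_def)
qed

section \<open>The corner of an ideal\<close>

definition corner :: "(nat \<Rightarrow> nat \<Rightarrow> 'a) set \<Rightarrow> 'a set" where
  "corner J = {a \<in> carrier A. matrix_unit a 1 n \<in> J}"

definition entrywise :: "'a set \<Rightarrow> (nat \<Rightarrow> nat \<Rightarrow> 'a) set" where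
  "entrywise K = {M \<in> carrier R. \<forall>i\<in>{1..n}. \<forall>j\<in>{1..n}. M i j \<in> K}"

lemma corner_unit_closed: "a \<in> carrier A \<Longrightarrow> matrix_unit a 1 n \<in> carrier R"
  using n_pos by (intro matrix_unit_closed) auto

lemma matrix_unit_zero: "matrix_unit \<zero> 1 n = \<zero>\<^bsub>R\<^esub>"
  by (rule matrix_eqI) (auto simp: corner_unit_closed matrix_unit_entry zero_entry_eq)

lemma ideal_corner:
  assumes J: "ideal J R"
  shows "ideal (corner J) A"
proof (rule ideal_if_closed)
  interpret J: ideal J R by (rule J)
  show "corner J \<subseteq> carrier A" by (auto simp: corner_def)
  show "\<zero> \<in> corner J" using J.zero_closed by (simp add: corner_def matrix_unit_zero)
  fix x assume x: "x \<in> corner J"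
  then have xc: "x \<in> carrier A" and xJ: "matrix_unit x 1 n \<in> J" by (auto simp: corner_def)
  show "x \<oplus> y \<in> corner J" if "y \<in> corner J" for y
  proof -
    have y: "y \<in> carrier A" "matrix_unit y 1 n \<in> J" using that by (auto simp: corner_def)
    have "matrix_unit (x \<oplus> y) 1 n = matrix_unit x 1 n \<oplus>\<^bsub>R\<^esub> matrix_unit y 1 n"
      using xc y by (intro matrix_eqI) (auto simp: corner_unit_closed matrix_unit_entry add_entry)
    then show ?thesis using xc xJ y by (simp add: corner_def)
  qed
  fix r assume r: "r \<in> carrier A"
  have "matrix_unit (r \<otimes> x) 1 n = scalar r \<otimes>\<^bsub>R\<^esub> matrix_unit x 1 n"
    using xc r by (intro matrix_eqI)
      (auto simp: corner_unit_closed scalar_closed scalar_mult_entry matrix_unit_entry)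
  then show "r \<otimes> x \<in> corner J"
    using xc xJ r scalar_closed by (simp add: corner_def J.I_l_closed)
  have "matrix_unit (x \<otimes> r) 1 n = matrix_unit x 1 n \<otimes>\<^bsub>R\<^esub> scalar r"
    using xc r by (intro matrix_eqI)
      (auto simp: corner_unit_closed scalar_closed mult_scalar_entry matrix_unit_entry)
  then show "x \<otimes> r \<in> corner J"
    using xc xJ r scalar_closed by (simp add: corner_def J.I_r_closed)
qed

text \<open>The identity \<open>E\<^sub>1\<^sub>i M E\<^sub>j\<^sub>n = M\<^sub>i\<^sub>j E\<^sub>1\<^sub>n\<close> moves any entry to the corner; both matrix units are
  upper triangular for all \<open>i\<close> and \<open>j\<close>, which is why this corner and no other is used.\<close>

lemma entry_in_corner:
  assumes J: "ideal J R" and M: "M \<in> J" and ij: "i \<in> {1..n}" "j \<in> {1..n}"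
  shows "M i j \<in> corner J"
proof -
  have Mc: "M \<in> carrier R" using ideal.Icarr[OF J M] .
  have one: "1 \<in> {1..n}" "n \<in> {1..n}" using n_pos by auto
  have u: "matrix_unit \<one> 1 i \<in> carrier R" "matrix_unit \<one> j n \<in> carrier R"
    using ij one by (auto intro!: matrix_unit_closed)
  let ?P = "matrix_unit \<one> 1 i \<otimes>\<^bsub>R\<^esub> M \<otimes>\<^bsub>R\<^esub> matrix_unit \<one> j n"
  have "?P \<in> J"
    using J M u by (intro ideal.I_r_closed ideal.I_l_closed)
  moreover have "?P = matrix_unit (M i j) 1 n"
    using u Mc ij one
    by (intro matrix_eqI)
      (auto simp: corner_unit_closed entry_closed mult_matrix_unit_entry matrix_unit_mult_entry
        matrix_unit_entry)
  ultimately show ?thesis using Mc ij by (simp add: corner_def entry_closed)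
qed

lemma corner_eq_zero_iff:
  assumes J: "ideal J R"
  shows "corner J = {\<zero>} \<longleftrightarrow> J = {\<zero>\<^bsub>R\<^esub>}"
proof
  have z: "\<zero>\<^bsub>R\<^esub> \<in> J" using additive_subgroup.zero_closed[OF ideal.axioms(1)[OF J]] .
  assume c: "corner J = {\<zero>}"
  have "M = \<zero>\<^bsub>R\<^esub>" if M: "M \<in> J" for M
    using entry_in_corner[OF J M] c ideal.Icarr[OF J M]
    by (intro matrix_eqI) (auto simp: zero_entry_eq)
  then show "J = {\<zero>\<^bsub>R\<^esub>}" using z by blast
next
  assume z: "J = {\<zero>\<^bsub>R\<^esub>}"
  have "a = \<zero>" if "matrix_unit a 1 n = \<zero>\<^bsub>R\<^esub>" for a
    using matrix_unit_entry[of 1 n a 1 n] zero_entry_eq[of 1 n] that n_pos by simp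
  then show "corner J = {\<zero>}" using z by (auto simp: corner_def matrix_unit_zero)
qed

lemma corner_Int: "corner (I \<inter> J) = corner I \<inter> corner J"
  by (auto simp: corner_def)

text \<open>A scalar matrix acts on each entry separately, so it fixes \<open>J\<close> as soon as \<open>c\<close> fixes the
  entries, all of which lie in the corner.\<close>

lemma fixed_corner_iff:
  assumes J: "ideal J R" and c: "c \<in> carrier A"
  shows "(\<forall>x\<in>corner J. c \<otimes> x = x) \<longleftrightarrow> (\<forall>M\<in>J. scalar c \<otimes>\<^bsub>R\<^esub> M = M)"
proof
  assume "\<forall>x\<in>corner J. c \<otimes> x = x"
  then show "\<forall>M\<in>J. scalar c \<otimes>\<^bsub>R\<^esub> M = M"
    using entry_in_corner[OF J] ideal.Icarr[OF J] c by (simp add: scalar_fixes_iff)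
next
  assume fixd: "\<forall>M\<in>J. scalar c \<otimes>\<^bsub>R\<^esub> M = M"
  show "\<forall>x\<in>corner J. c \<otimes> x = x"
  proof
    fix x assume "x \<in> corner J"
    then have "x \<in> carrier A" "scalar c \<otimes>\<^bsub>R\<^esub> matrix_unit x 1 n = matrix_unit x 1 n"
      using fixd by (auto simp: corner_def)
    then have "c \<otimes> matrix_unit x 1 n 1 n = matrix_unit x 1 n 1 n"
      using n_pos c by (simp add: scalar_fixes_iff corner_unit_closed)
    then show "c \<otimes> x = x" using n_pos by (simp add: matrix_unit_entry)
  qed
qed

text \<open>The entries of a product with a factor from \<open>K\<close> are sums of elements of \<open>K\<close>; that they lie in
  the prescribed \<open>X i j\<close> is the closure of \<open>R\<close> under multiplication.\<close>

lemma ideal_entrywise: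
  assumes K: "ideal K A"
  shows "ideal (entrywise K) R"
proof (rule R.ideal_if_closed)
  interpret K: ideal K A by (rule K)
  have finsum_K: "(\<Oplus>k\<in>{1..n}. f k) \<in> K" if "\<And>k. k \<in> {1..n} \<Longrightarrow> f k \<in> K" for f
  proof -
    have "S \<subseteq> {1..n} \<Longrightarrow> (\<Oplus>k\<in>S. f k) \<in> K" if "finite S" for S
      using that
    proof (induction S rule: finite_induct)
      case (insert k S)
      have "f \<in> S \<rightarrow> carrier A" "f k \<in> carrier A"
        using insert.prems \<open>\<And>k. k \<in> {1..n} \<Longrightarrow> f k \<in> K\<close> K.Icarr by auto
      then show ?case
        using insert \<open>\<And>k. k \<in> {1..n} \<Longrightarrow> f k \<in> K\<close> by simp
    qed simp
    then show ?thesis by simp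
  qed
  show "entrywise K \<subseteq> carrier R" by (auto simp: entrywise_def)
  show "\<zero>\<^bsub>R\<^esub> \<in> entrywise K" by (simp add: entrywise_def zero_entry_eq)
  fix M assume M: "M \<in> entrywise K"
  show "M \<oplus>\<^bsub>R\<^esub> N \<in> entrywise K" if "N \<in> entrywise K" for N
    using M that by (simp add: entrywise_def add_entry)
  fix N assume N: "N \<in> carrier R"
  show "N \<otimes>\<^bsub>R\<^esub> M \<in> entrywise K"
    using M N by (auto simp: entrywise_def mult_entry entry_closed
        intro!: finsum_K K.I_l_closed)
  show "M \<otimes>\<^bsub>R\<^esub> N \<in> entrywise K"
    using M N by (auto simp: entrywise_def mult_entry entry_closed
        intro!: finsum_K K.I_r_closed)
qed

lemma corner_entrywise:
  assumes K: "ideal K A"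
  shows "corner (entrywise K) = K"
proof (intro equalityI subsetI)
  fix a assume "a \<in> corner (entrywise K)"
  then have "matrix_unit a 1 n 1 n \<in> K" using n_pos by (auto simp: corner_def entrywise_def)
  then show "a \<in> K" using n_pos by (simp add: matrix_unit_entry)
next
  fix a assume a: "a \<in> K"
  have "\<zero> \<in> K" using additive_subgroup.zero_closed[OF ideal.axioms(1)[OF K]] .
  then show "a \<in> corner (entrywise K)"
    using a ideal.Icarr[OF K a]
    by (auto simp: corner_def entrywise_def corner_unit_closed matrix_unit_entry)
qed

section \<open>Transfer along the corner map\<close>

theorem ideal_extending_iff_gen_matrix_ring: "ideal_extending A \<longleftrightarrow> ideal_extending R"
proof -
  \<comment> \<open>Every ideal of \<open>A\<close> is a corner, so quantifiers over ideals can be moved to \<open>R\<close>.\<close>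
  have transfer: "(\<forall>K. ideal K A \<longrightarrow> P K) \<longleftrightarrow> (\<forall>J. ideal J R \<longrightarrow> P (corner J))" for P
    using ideal_corner ideal_entrywise corner_entrywise by metis
  have test: "(\<forall>x\<in>corner J. c \<otimes> x = x) \<and>
      (\<forall>I. ideal I A \<and> I \<noteq> {\<zero>} \<and> (\<forall>x\<in>I. c \<otimes> x = x) \<longrightarrow> corner J \<inter> I \<noteq> {\<zero>}) \<longleftrightarrow>
    (\<forall>M\<in>J. scalar c \<otimes>\<^bsub>R\<^esub> M = M) \<and>
      (\<forall>I. ideal I R \<and> I \<noteq> {\<zero>\<^bsub>R\<^esub>} \<and> (\<forall>M\<in>I. scalar c \<otimes>\<^bsub>R\<^esub> M = M) \<longrightarrow> J \<inter> I \<noteq> {\<zero>\<^bsub>R\<^esub>})"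
    if J: "ideal J R" and c: "c \<in> carrier A" for J c
  proof -
    have "(\<forall>I. ideal I A \<longrightarrow>
          (I \<noteq> {\<zero>} \<and> (\<forall>x\<in>I. c \<otimes> x = x) \<longrightarrow> corner J \<inter> I \<noteq> {\<zero>})) \<longleftrightarrow>
        (\<forall>I. ideal I R \<longrightarrow> (I \<noteq> {\<zero>\<^bsub>R\<^esub>} \<and> (\<forall>M\<in>I. scalar c \<otimes>\<^bsub>R\<^esub> M = M) \<longrightarrow>
          J \<inter> I \<noteq> {\<zero>\<^bsub>R\<^esub>}))"
      unfolding transfer
      using corner_eq_zero_iff fixed_corner_iff[OF _ c] corner_eq_zero_iff[OF R.i_intersect[OF J]]
      by (simp add: corner_Int cong: imp_cong)
    then show ?thesis using fixed_corner_iff[OF J c] by (simp add: imp_conjL)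
  qed
  have "central_idempotents A \<subseteq> carrier A" by (auto simp: central_idempotents_def)
  then show ?thesis
    unfolding ideal_extending_iff R.ideal_extending_iff transfer
      central_idempotents_gen_matrix_ring bex_simps
    using test by (simp add: subset_iff cong: imp_cong bex_cong)
qed

end

theorem corollary2p21:
  fixes A :: "('a, 'b) ring_scheme" and n :: nat and X :: "nat \<Rightarrow> nat \<Rightarrow> 'a set"
  assumes "ring A"
    and "n \<ge> 1"
    and "\<And>i j. i \<in> {1..n} \<Longrightarrow> j \<in> {1..n} \<Longrightarrow> i \<le> j \<Longrightarrow> X i j = carrier A"
    and "\<And>i j. i \<in> {1..n} \<Longrightarrow> j \<in> {1..n} \<Longrightarrow> j < i \<Longrightarrow> ideal (X i j) A"
    and "\<And>j k. j \<in> {1..n} \<Longrightarrow> k \<in> {1..<n} \<Longrightarrow> X j k \<subseteq> X j (k + 1)"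
    and "\<And>i k. i \<in> {1..n} \<Longrightarrow> k \<in> {1..<n} \<Longrightarrow> X (k + 1) i \<subseteq> X k i"
    and "ring (gen_matrix_ring A n X)"
  shows "ideal_extending A \<longleftrightarrow> ideal_extending (gen_matrix_ring A n X)"
proof -
  have "ideal (X i j) A" if "i \<in> {1..n}" "j \<in> {1..n}" for i j
    using assms(3,4) ring.oneideal[OF assms(1)] that by (cases "i \<le> j") auto
  then interpret upper_gen_matrix_ring A n X
    using assms(1-3,7) by (intro upper_gen_matrix_ring.intro upper_gen_matrix_ring_axioms.intro)
  show ?thesis by (rule ideal_extending_iff_gen_matrix_ring)
qed

end
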